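(* Let $U\subset\mathbb{R}^n$ be open, let $k\ge1$ be an integer, let $\phi\in C^{2k}(U)$, and let $x\in U$. Then, as $\varepsilon\to0^+$ (over $\varepsilon$ with $\overline{B_\varepsilon(x)}\subset U$), $$\int_{B_\varepsilon(0)}\phi(x+h)\rho_\varepsilon(h)\,dh=\sum_{j=0}^{k}c_{j,n}\,\varepsilon^{2j}\,\Delta^j\phi(x)+o(\varepsilon^{2k}),$$ where $c_{0,n}=1$ and, for $1\le j\le k$, $$c_{j,n}=\frac{1}{2^j\,j!\,(n+3)(n+5)\cdots(n+2j+1)}=\frac{1}{4^j\,j!}\,\frac{\Gamma\!\left(\frac{n+3}{2}\right)}{\Gamma\!\left(j+\frac{n+3}{2}\right)}.$$ In particular, only even powers of $\varepsilon$ occur in the expansion.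
   Context: $B_\varepsilon(x)$ is the open ball in $\mathbb{R}^n$ of radius $\varepsilon$ centered at $x$, $|B^{n+1}_\varepsilon|$ is the Lebesgue volume of a ball of radius $\varepsilon$ in $\mathbb{R}^{n+1}$, and $$\rho_\varepsilon(h)=\frac{2\sqrt{\varepsilon^2-|h|^2}}{|B_\varepsilon^{n+1}|},\qquad h\in B_\varepsilon(0)\subset\mathbb{R}^n.$$ $\Delta^j$ denotes the $j$-th iterate of the Laplacian ($\Delta^0$ is the identity). *)

theory Defs
  imports "HOL-Analysis.Analysis" "HOL-Library.Landau_Symbols"
begin

definition partial_deriv :: "'a::euclidean_space \<Rightarrow> ('a \<Rightarrow> real) \<Rightarrow> 'a \<Rightarrow> real" where
  "partial_deriv b f x = deriv (\<lambda>t. f (x + t *\<^sub>R b)) 0"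

(* C_on k U f is meant for open U.  It expresses f \<in> C^k(U) by the usual recursion: f is
   (totally) differentiable on U and all its first partial derivatives are C^(k-1) on U.
   Values of f outside U are irrelevant. *)
primrec C_on :: "nat \<Rightarrow> 'a::euclidean_space set \<Rightarrow> ('a \<Rightarrow> real) \<Rightarrow> bool" where
  "C_on 0 U f \<longleftrightarrow> continuous_on U f"
| "C_on (Suc k) U f \<longleftrightarrow>
     (\<forall>x\<in>U. f differentiable (at x)) \<and> (\<forall>b\<in>Basis. C_on k U (partial_deriv b f))"

definition laplacian :: "('a::euclidean_space \<Rightarrow> real) \<Rightarrow> 'a \<Rightarrow> real" where
  "laplacian f x = (\<Sum>b\<in>Basis. partial_deriv b (partial_deriv b f) x)"

(* If n = DIM('a), then 'a \<times> real with its product norm is Euclidean (n+1)-space. *)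
definition rho :: "real \<Rightarrow> 'a::euclidean_space \<Rightarrow> real" where
  "rho \<epsilon> h = 2 * sqrt (\<epsilon>\<^sup>2 - (norm h)\<^sup>2) / measure lborel (ball (0 :: 'a \<times> real) \<epsilon>)"

(* The factors are n+3, n+5, ..., n+2j+1; the product is empty for j = 0. *)
definition expansion_coeff :: "nat \<Rightarrow> nat \<Rightarrow> real" where
  "expansion_coeff j n = 1 / (2 ^ j * fact j * (\<Prod>i=1..j. real (n + 2 * i + 1)))"

lemma partial_deriv_eq_frechet_derivative:
  assumes "f differentiable (at x)"
  shows "partial_deriv b f x = frechet_derivative f (at x) b"
proof -
  let ?D = "frechet_derivative f (at x)"
  have D: "(f has_derivative ?D) (at (x + 0 *\<^sub>R b))"
    using assms by (simp add: frechet_derivative_works)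
  have L: "((\<lambda>t::real. x + t *\<^sub>R b) has_derivative (\<lambda>t. t *\<^sub>R b)) (at 0)"
    by (auto intro!: derivative_eq_intros)
  have "((\<lambda>t. f (x + t *\<^sub>R b)) has_derivative (\<lambda>t. ?D (t *\<^sub>R b))) (at 0)"
    using diff_chain_at[OF L D] by (simp add: o_def)
  moreover have "?D (t *\<^sub>R b) = ?D b * t" for t
    using linear_frechet_derivative[OF assms] by (simp add: linear_cmul)
  ultimately have "((\<lambda>t. f (x + t *\<^sub>R b)) has_field_derivative ?D b) (at 0)"
    by (simp add: has_field_derivative_def)
  then show ?thesis
    unfolding partial_deriv_def by (rule DERIV_imp_deriv)
qed

end

theory Submission imports Defs begin

text \<open>
  After rescaling, the average is a multiple of \<open>M\<^sub>0(\<epsilon>) = \<integral> \<phi>(x + \<epsilon>h) w\<^sub>0(h) dh\<close>, where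
  \<open>w\<^sub>m(h) = (1 - |h|\<^sup>2)\<^sub>+\<close> to the power \<open>m + 1/2\<close>.  No Taylor expansion or moment computation is
  needed: since the gradient of \<open>w\<^bsub>m+1\<^esub>\<close> is \<open>-(2m + 3) h w\<^sub>m(h)\<close>, differentiating in \<open>\<epsilon>\<close> and
  integrating by parts gives
  \<open>M\<^sub>m[\<phi>]'(\<epsilon>) = \<epsilon> / (2m + 3) M\<^bsub>m+1\<^esub>[\<Delta>\<phi>](\<epsilon>)\<close>,
  so the expansion of \<open>M\<^sub>m[\<phi>]\<close> to order \<open>2k + 2\<close> is obtained by integrating the expansion of
  \<open>M\<^bsub>m+1\<^esub>[\<Delta>\<phi>]\<close> to order \<open>2k\<close>.
  The coefficients follow from \<open>(2m + 3) \<integral> w\<^sub>m = (n + 2m + 3) \<integral> w\<^bsub>m+1\<^esub>\<close>, which shifts the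
  dimension parameter \<open>n + 2m\<close> of the expansion coefficients by two.
\<close>

subsection \<open>The weights and integration by parts\<close>

text \<open>The odd power of a square root encodes the half-integer exponent. Truncating with
  \<open>max 0\<close> extends the weight continuously by zero beyond the unit ball, so every
  integral can run over one fixed box.\<close>

definition wt :: "nat \<Rightarrow> 'a::euclidean_space \<Rightarrow> real" where
  "wt m h = sqrt (max 0 (1 - (norm h)\<^sup>2)) ^ (2 * m + 1)"

text \<open>
  Larger than the support of the weights, so that translating an integrand by at most \<open>1\<close> does not
  change its integral over the box.
\<close>
definition bigbox :: "'a::euclidean_space set" where
  "bigbox = cbox (- (2 *\<^sub>R One)) (2 *\<^sub>R One)"

lemma wt_eq_0: "1 \<le> norm h \<Longrightarrow> wt m h = 0"
  by (simp add: wt_def max_def power2_eq_square)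
     (metis abs_le_square_iff abs_norm_cancel abs_one antisym_conv1 not_le one_power2 power2_eq_square less_eq_real_def)

lemma wt_nonneg: "0 \<le> wt m h"
  by (simp add: wt_def)

lemma continuous_on_wt [continuous_intros]:
  "continuous_on S f \<Longrightarrow> continuous_on S (\<lambda>x. wt m (f x))"
  unfolding wt_def by (intro continuous_intros)

lemma cball_subset_bigbox: "cball 0 2 \<subseteq> (bigbox :: 'a::euclidean_space set)"
proof
  fix h :: 'a assume "h \<in> cball 0 2"
  then have "\<bar>h \<bullet> i\<bar> \<le> 2" if "i \<in> Basis" for i
    using Basis_le_norm[OF that, of h] by simp
  then show "h \<in> bigbox"
    by (force simp: bigbox_def mem_box abs_le_iff)
qed

lemma wt_eq_0_outside: "h \<notin> bigbox \<Longrightarrow> wt m h = 0"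
  using cball_subset_bigbox by (intro wt_eq_0) (force simp: subset_iff)

lemma wt_Suc: "wt (Suc m) h = (1 - (norm h)\<^sup>2) * wt m h"
proof (cases "norm h < 1")
  case True
  then have "0 \<le> 1 - (norm h)\<^sup>2" by (simp add: power_le_one)
  then show ?thesis by (simp add: wt_def max_def power2_eq_square)
next
  case False
  then show ?thesis by (simp add: wt_eq_0)
qed

section \<open>Differentiability of the weights\<close>

text \<open>The exponent is at least 3, so the derivative tends to 0 on both sides of the kink at
  \<open>u = 0\<close>. With exponent 1 this fails, which is why only \<open>wt (Suc m)\<close> is
  ever differentiated.\<close>

lemma DERIV_sqrt_max_power:
  fixes u :: real
  shows "((\<lambda>u. sqrt (max 0 u) ^ (2 * m + 3)) has_field_derivative
           (2 * real m + 3) / 2 * sqrt (max 0 u) ^ (2 * m + 1)) (at u)"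
proof -
  consider "u > 0" | "u < 0" | "u = 0" by linarith
  then show ?thesis
  proof cases
    case 1
    have "sqrt u ^ (2 * m + 2) = sqrt u ^ (2 * m + 1) * sqrt u" by simp
    then have "real (2 * m + 3) * (inverse (sqrt u) / 2 * sqrt u ^ (2 * m + 2)) =
        (2 * real m + 3) / 2 * sqrt u ^ (2 * m + 1)"
      using 1 by (simp add: field_simps)
    moreover have "((\<lambda>u. sqrt u ^ (2 * m + 3)) has_field_derivative
           real (2 * m + 3) * (inverse (sqrt u) / 2 * sqrt u ^ (2 * m + 2))) (at u)"
      using DERIV_power[OF DERIV_real_sqrt[OF 1], of "2 * m + 3"] by (simp del: power_Suc power_add)
    ultimately have "((\<lambda>u. sqrt u ^ (2 * m + 3)) has_field_derivative
           (2 * real m + 3) / 2 * sqrt u ^ (2 * m + 1)) (at u)"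
      by metis
    then have "((\<lambda>u. sqrt (max 0 u) ^ (2 * m + 3)) has_field_derivative
           (2 * real m + 3) / 2 * sqrt u ^ (2 * m + 1)) (at u)"
      by (rule has_field_derivative_transform_within_open[where S = "{0<..}"]) (use 1 in auto)
    then show ?thesis using 1 by simp
  next
    case 2
    have "((\<lambda>u. 0) has_field_derivative 0) (at u)" by simp
    then have "((\<lambda>u. sqrt (max 0 u) ^ (2 * m + 3)) has_field_derivative 0) (at u)"
      by (rule has_field_derivative_transform_within_open[where S = "{..<0}"]) (use 2 in auto)
    then show ?thesis using 2 by simp
  next
    case 3
    \<comment> \<open>At the kink the difference quotient is itself
      \<open>sqrt (max 0 h) ^ (2 * m + 1)\<close>, which is continuous and vanishes at 0.\<close>
    have "((\<lambda>h. sqrt (max 0 h) ^ (2 * m + 1)) \<longlongrightarrow> sqrt (max 0 0) ^ (2 * m + 1)) (at (0::real))"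
      by (intro tendsto_intros)
    then have "((\<lambda>h. sqrt (max 0 h) ^ (2 * m + 1)) \<longlongrightarrow> 0) (at (0::real))" by simp
    moreover have "sqrt (max 0 h) ^ (2 * m + 1) = sqrt (max 0 h) ^ (2 * m + 3) / h" if "h > 0" for h :: real
      using that by (simp add: power_add eval_nat_numeral field_simps)
    then have "sqrt (max 0 h) ^ (2 * m + 1) = sqrt (max 0 h) ^ (2 * m + 3) / h" if "h \<noteq> 0" for h :: real
      using that by (cases "h > 0") auto
    ultimately have "((\<lambda>h. sqrt (max 0 h) ^ (2 * m + 3) / h) \<longlongrightarrow> 0) (at (0::real))"
      by (auto intro: Lim_transform_eventually simp: eventually_at_filter)
    then show ?thesis using 3 by (simp add: DERIV_def power_0_left)
  qed
qed

lemma DERIV_wt_line: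
  fixes h b :: "'a::euclidean_space"
  shows "((\<lambda>t. wt (Suc m) (h + t *\<^sub>R b)) has_field_derivative
            - ((2 * real m + 3) * ((h + t *\<^sub>R b) \<bullet> b) * wt m (h + t *\<^sub>R b))) (at t)"
proof -
  have n: "(norm (h + t *\<^sub>R b))\<^sup>2 = h \<bullet> h + 2 * t * (h \<bullet> b) + t\<^sup>2 * (b \<bullet> b)" for t
    unfolding power2_norm_eq_inner by (simp add: algebra_simps inner_commute power2_eq_square)
  have d: "((\<lambda>t. 1 - (norm (h + t *\<^sub>R b))\<^sup>2) has_field_derivative - (2 * ((h + t *\<^sub>R b) \<bullet> b))) (at t)"
    unfolding n by (auto intro!: derivative_eq_intros simp: algebra_simps)
  show ?thesis
  proof (rule DERIV_cong)
    have "2 * Suc m + 1 = 2 * m + 3" by simp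
    then show "((\<lambda>t. wt (Suc m) (h + t *\<^sub>R b)) has_field_derivative
        (2 * real m + 3) / 2 * wt m (h + t *\<^sub>R b) * - (2 * ((h + t *\<^sub>R b) \<bullet> b))) (at t)"
      using DERIV_chain2[OF DERIV_sqrt_max_power d, of m] unfolding wt_def by metis
  qed simp
qed

section \<open>Translation invariance and integration by parts\<close>

text \<open>Translating by at most 1 keeps the support inside the ball of radius 2, hence inside
  \<open>bigbox\<close>, so both sides are integrals over the whole space.\<close>

lemma integral_shift_compact_support:
  fixes F :: "'a::euclidean_space \<Rightarrow> real"
  assumes "\<And>h. 1 \<le> norm h \<Longrightarrow> F h = 0" and "norm c \<le> 1"
  shows "integral bigbox (\<lambda>h. F (h + c)) = integral bigbox F"
proof -
  have eq: "integral T G = integral UNIV G" if "\<And>h. h \<notin> T \<Longrightarrow> G h = 0" for T and G :: "'a \<Rightarrow> real"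
  proof -
    have "(\<lambda>h. if h \<in> T then G h else 0) = G"
      using that by fastforce
    then show ?thesis using integral_restrict_UNIV[of T G] by simp
  qed
  have F: "F h = 0" if "h \<notin> bigbox" for h
    using that cball_subset_bigbox by (intro assms(1)) (force simp: subset_iff)
  have "F (h + c) = 0" if "h \<notin> bigbox" for h
  proof (rule assms(1))
    have "2 < norm h" using that cball_subset_bigbox by (force simp: subset_iff)
    then show "1 \<le> norm (h + c)" using assms(2) norm_triangle_ineq4[of "h + c" c] by simp
  qed
  then have "integral bigbox (\<lambda>h. F (h + c)) = integral UNIV (\<lambda>h. F (h + c))"
    by (rule eq)
  \<comment> \<open>The new domain is \<open>bigbox\<close> shifted by \<open>-c\<close>; the
    integrand vanishes outside it too, and there the substitution is exact.\<close>
  also have "\<dots> = integral (cbox (- (2 *\<^sub>R One) - c) (2 *\<^sub>R One - c)) (\<lambda>h. F (h + c))"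
    by (rule eq[symmetric], rule F)
       (auto simp: bigbox_def mem_box inner_diff_left inner_add_left diff_le_eq le_diff_eq)
  also have "\<dots> = integral bigbox F"
    unfolding bigbox_def by (rule integral_shift_cbox)
  finally show ?thesis .
qed

text \<open>
  The integral of \<open>\<psi> w\<^bsub>m+1\<^esub>\<close> is invariant under translation in direction \<open>b\<close>, so its derivative
  with respect to the translation vanishes.
\<close>
lemma integral_by_parts_wt:
  fixes \<psi> \<psi>' :: "'a::euclidean_space \<Rightarrow> real"
  assumes b: "b \<in> Basis"
    and S: "\<And>h t. h \<in> bigbox \<Longrightarrow> \<bar>t\<bar> \<le> 1 \<Longrightarrow> h + t *\<^sub>R b \<in> S"
    and der: "\<And>h. h \<in> S \<Longrightarrow> ((\<lambda>t. \<psi> (h + t *\<^sub>R b)) has_field_derivative \<psi>' h) (at 0)"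
    and cont: "continuous_on S \<psi>" "continuous_on S \<psi>'"
  shows "(2 * real m + 3) * integral bigbox (\<lambda>h. \<psi> h * (h \<bullet> b) * wt m h)
       = integral bigbox (\<lambda>h. \<psi>' h * wt (Suc m) h)"
proof -
  define F where "F h = \<psi> h * wt (Suc m) h" for h
  define F' where "F' h = \<psi>' h * wt (Suc m) h - (2 * real m + 3) * (\<psi> h * (h \<bullet> b) * wt m h)" for h
  let ?T = "{-1..1::real}"
  have Sb: "h \<in> S" if "h \<in> bigbox" for h using S[OF that, of 0] by simp
  have cF: "continuous_on S F" "continuous_on S F'"
    unfolding F_def F'_def by (intro continuous_intros cont)+
  have dF: "((\<lambda>t. F (h + t *\<^sub>R b)) has_field_derivative F' (h + t *\<^sub>R b)) (at t within ?T)"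
    if "t \<in> ?T" "h \<in> bigbox" for t h
  proof -
    \<comment> \<open>\<open>der\<close> differentiates only at parameter 0; applied at the moved
      base point it gives the derivative at \<open>t\<close>.\<close>
    have "h + t *\<^sub>R b \<in> S" using that by (intro S) auto
    from der[OF this] have "((\<lambda>s. \<psi> (h + (s + t) *\<^sub>R b)) has_field_derivative \<psi>' (h + t *\<^sub>R b)) (at 0)"
      by (simp add: algebra_simps)
    then have "((\<lambda>t. \<psi> (h + t *\<^sub>R b)) has_field_derivative \<psi>' (h + t *\<^sub>R b)) (at t)"
      using DERIV_shift[of "\<lambda>t. \<psi> (h + t *\<^sub>R b)" "\<psi>' (h + t *\<^sub>R b)" 0 t] by simp
    from DERIV_mult[OF this DERIV_wt_line[of m h b t]]
    have "((\<lambda>t. F (h + t *\<^sub>R b)) has_field_derivative F' (h + t *\<^sub>R b)) (at t)"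
      unfolding F_def F'_def by (simp add: algebra_simps)
    then show ?thesis by (rule has_field_derivative_at_within)
  qed
  have "((\<lambda>t. integral bigbox (\<lambda>h. F (h + t *\<^sub>R b))) has_field_derivative
          integral bigbox (\<lambda>h. F' (h + 0 *\<^sub>R b))) (at 0 within ?T)"
    unfolding bigbox_def
  proof (rule leibniz_rule_field_derivative[where fx = "\<lambda>t h. F' (h + t *\<^sub>R b)"], unfold bigbox_def[symmetric])
    show "(\<lambda>h. F (h + t *\<^sub>R b)) integrable_on bigbox" if "t \<in> ?T" for t
      unfolding bigbox_def
      by (intro integrable_continuous continuous_on_compose2[OF cF(1)] continuous_intros)
         (use S that in \<open>auto simp: bigbox_def[symmetric] abs_le_iff\<close>)
    show "continuous_on (?T \<times> bigbox) (\<lambda>(t, h). F' (h + t *\<^sub>R b))"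
      unfolding case_prod_beta
      by (intro continuous_on_compose2[OF cF(2)] continuous_intros) (use S in \<open>auto simp: abs_le_iff\<close>)
  qed (use dF in auto)
  then have "((\<lambda>t. integral bigbox (\<lambda>h. F (h + t *\<^sub>R b))) has_field_derivative integral bigbox F') (at 0 within ?T)"
    by simp
  moreover have "integral bigbox (\<lambda>h. F (h + t *\<^sub>R b)) = integral bigbox F" if "t \<in> ?T" for t
    using that b by (intro integral_shift_compact_support) (auto simp: F_def wt_eq_0)
  ultimately have "((\<lambda>t. integral bigbox F) has_field_derivative integral bigbox F') (at 0 within ?T)"
    by - (rule has_field_derivative_transform_within[where d = 1], assumption, simp_all)
  \<comment> \<open>Since 0 is interior to \<open>?T\<close>, this is a two-sided derivative, and
    that of a constant is unique.\<close>
  then have "((\<lambda>t. integral bigbox F) has_field_derivative integral bigbox F') (at 0)"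
    by (simp add: at_within_Icc_at)
  then have "integral bigbox F' = 0"
    by (rule DERIV_unique) (rule DERIV_const)
  moreover have "(\<lambda>h. \<psi>' h * wt (Suc m) h) integrable_on bigbox"
      "(\<lambda>h. \<psi> h * (h \<bullet> b) * wt m h) integrable_on bigbox"
    unfolding bigbox_def
    by (intro integrable_continuous continuous_intros continuous_on_subset[OF cont(1)]
          continuous_on_subset[OF cont(2)]; use Sb in \<open>auto simp: bigbox_def\<close>)+
  ultimately show ?thesis
    unfolding F'_def by (simp add: integral_diff integrable_on_mult_right)
qed

lemma integrable_on_bigbox:
  fixes f :: "'a::euclidean_space \<Rightarrow> real"
  shows "continuous_on bigbox f \<Longrightarrow> f integrable_on bigbox"
  unfolding bigbox_def by (rule integrable_continuous)

text \<open>Integration by parts with \<open>\<psi> h = h \<bullet> b\<close>, summed over the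
  basis, evaluates the integral of \<open>(norm h)\<^sup>2 * wt m h\<close>; \<open>wt_Suc\<close>
  supplies the complementary part of the integral of \<open>wt m\<close>.\<close>

lemma integral_wt_Suc:
  "(2 * real m + 3) * integral bigbox (wt m :: 'a::euclidean_space \<Rightarrow> real)
     = (real DIM('a) + 2 * real m + 3) * integral bigbox (wt (Suc m) :: 'a \<Rightarrow> real)"
proof -
  have c: "continuous_on S (wt m :: 'a \<Rightarrow> real)" for S m
    using continuous_on_wt[OF continuous_on_id] by simp
  have ibp: "(2 * real m + 3) * integral bigbox (\<lambda>h. (h \<bullet> b) * (h \<bullet> b) * wt m h) = integral bigbox (wt (Suc m) :: 'a \<Rightarrow> real)"
    if "b \<in> Basis" for b :: 'a
  proof -
    have "((\<lambda>t. (h + t *\<^sub>R b) \<bullet> b) has_field_derivative 1) (at 0)" for h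
      using that by (auto intro!: derivative_eq_intros simp: inner_add_left)
    from integral_by_parts_wt[OF that, of UNIV "\<lambda>h. h \<bullet> b" "\<lambda>_. 1" m, OF _ this]
    show ?thesis by (simp add: continuous_intros)
  qed
  have i: "(\<lambda>h. (h \<bullet> b) * (h \<bullet> b) * wt m h) integrable_on bigbox" for b :: 'a
    by (intro integrable_on_bigbox continuous_intros)
  have "integral bigbox (\<lambda>h::'a. (norm h)\<^sup>2 * wt m h)
      = integral bigbox (\<lambda>h::'a. \<Sum>b\<in>Basis. (h \<bullet> b) * (h \<bullet> b) * wt m h)"
    by (simp only: power2_norm_eq_inner euclidean_inner[of h h for h] sum_distrib_right)
  also have "\<dots> = (\<Sum>b\<in>Basis. integral bigbox (\<lambda>h::'a. (h \<bullet> b) * (h \<bullet> b) * wt m h))"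
    by (intro integral_sum i) auto
  finally have *: "(2 * real m + 3) * integral bigbox (\<lambda>h::'a. (norm h)\<^sup>2 * wt m h)
      = real DIM('a) * integral bigbox (wt (Suc m) :: 'a \<Rightarrow> real)"
    by (simp add: sum_distrib_left ibp)
  have "integral bigbox (wt (Suc m) :: 'a \<Rightarrow> real)
      = integral bigbox (\<lambda>h::'a. wt m h - (norm h)\<^sup>2 * wt m h)"
    by (intro integral_cong) (simp add: wt_Suc algebra_simps)
  also have "\<dots> = integral bigbox (wt m :: 'a \<Rightarrow> real) - integral bigbox (\<lambda>h::'a. (norm h)\<^sup>2 * wt m h)"
    by (intro integral_diff integrable_on_bigbox continuous_intros c)
  finally have eq: "integral bigbox (wt m :: 'a \<Rightarrow> real)
      = integral bigbox (wt (Suc m) :: 'a \<Rightarrow> real) + integral bigbox (\<lambda>h::'a. (norm h)\<^sup>2 * wt m h)"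
    by simp
  show ?thesis
    unfolding eq distrib_left * by (simp add: algebra_simps)
qed

subsection \<open>Functions of class \<open>C\<^sup>k\<close>\<close>

text \<open>\<open>partial_deriv\<close> is built on \<open>deriv\<close>, which is informative only
  where a derivative exists; total differentiability supplies existence.\<close>

lemma differentiable_has_partial_deriv:
  assumes "f differentiable (at y)"
  shows "((\<lambda>t. f (y + t *\<^sub>R b)) has_field_derivative partial_deriv b f y) (at 0)"
proof -
  have D: "(f has_derivative frechet_derivative f (at y)) (at (y + 0 *\<^sub>R b))"
    using assms by (simp add: frechet_derivative_works)
  have L: "((\<lambda>t::real. y + t *\<^sub>R b) has_derivative (\<lambda>t. t *\<^sub>R b)) (at 0)"
    by (auto intro!: derivative_eq_intros)
  have "frechet_derivative f (at y) (t *\<^sub>R b) = partial_deriv b f y * t" for t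
    using linear_frechet_derivative[OF assms] partial_deriv_eq_frechet_derivative[OF assms, of b]
    by (simp add: linear_cmul)
  with diff_chain_at[OF L D] show ?thesis
    by (simp add: o_def has_field_derivative_def)
qed

text \<open>The chain rule along a ray, in coordinates: each summand carries a factor
  \<open>h \<bullet> b\<close>, the shape that integration by parts consumes.\<close>

lemma has_field_derivative_radial:
  fixes x h :: "'a::euclidean_space"
  assumes "f differentiable (at (x + \<epsilon> *\<^sub>R h))"
  shows "((\<lambda>\<epsilon>. f (x + \<epsilon> *\<^sub>R h)) has_field_derivative
            (\<Sum>b\<in>Basis. (h \<bullet> b) * partial_deriv b f (x + \<epsilon> *\<^sub>R h))) (at \<epsilon>)"
proof -
  let ?D = "frechet_derivative f (at (x + \<epsilon> *\<^sub>R h))"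
  have D: "(f has_derivative ?D) (at (x + \<epsilon> *\<^sub>R h))"
    using assms by (simp add: frechet_derivative_works)
  have L: "((\<lambda>t. x + t *\<^sub>R h) has_derivative (\<lambda>t. t *\<^sub>R h)) (at \<epsilon>)"
    by (auto intro!: derivative_eq_intros)
  have lin: "linear ?D" by (rule linear_frechet_derivative[OF assms])
  have "?D h = ?D (\<Sum>b\<in>Basis. (h \<bullet> b) *\<^sub>R b)"
    by (simp add: euclidean_representation)
  also have "\<dots> = (\<Sum>b\<in>Basis. (h \<bullet> b) * partial_deriv b f (x + \<epsilon> *\<^sub>R h))"
    by (simp add: linear_sum[OF lin] linear_cmul[OF lin] partial_deriv_eq_frechet_derivative[OF assms])
  finally have "?D (t *\<^sub>R h) = (\<Sum>b\<in>Basis. (h \<bullet> b) * partial_deriv b f (x + \<epsilon> *\<^sub>R h)) * t" for t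
    by (simp add: linear_cmul[OF lin])
  with diff_chain_at[OF L D] show ?thesis
    by (simp add: o_def has_field_derivative_def)
qed

text \<open>Derivatives at points of an open set depend only on values there. This is needed because
  rules such as additivity of partial derivatives hold only on \<open>U\<close>, while
  \<open>C_on\<close> takes functions on the whole space.\<close>

lemma C_on_cong:
  assumes "open U" "\<And>y. y \<in> U \<Longrightarrow> f y = g y" "C_on k U f"
  shows "C_on k U g"
  using assms(2,3)
proof (induction k arbitrary: f g)
  case 0
  then show ?case by (simp cong: continuous_on_cong)
next
  case (Suc k)
  have D: "(g has_derivative D) (at y)" if "(f has_derivative D) (at y)" "y \<in> U" for D y
    using that(1) \<open>open U\<close> that(2) by (rule has_derivative_transform_within_open) (use Suc.prems in auto)
  have d: "g differentiable (at y)" if "y \<in> U" for y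
    using Suc.prems that D unfolding C_on.simps differentiable_def by blast
  have "partial_deriv b f y = partial_deriv b g y" if "y \<in> U" for b y
  proof -
    have f: "f differentiable (at y)" using Suc.prems that by simp
    then have "frechet_derivative f (at y) = frechet_derivative g (at y)"
      using D[OF _ that] frechet_derivative_at frechet_derivative_works by metis
    then show ?thesis
      using d[OF that] f by (simp add: partial_deriv_eq_frechet_derivative)
  qed
  then have "C_on k U (partial_deriv b g)" if "b \<in> Basis" for b
    using Suc.IH[of "partial_deriv b f" "partial_deriv b g"] Suc.prems that by auto
  then show ?case using d by simp
qed

lemma C_on_imp_continuous_on: "C_on k U f \<Longrightarrow> continuous_on U f"
  by (cases k)
     (auto intro!: continuous_at_imp_continuous_on intro: differentiable_imp_continuous_within)

lemma partial_deriv_add: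
  assumes "f differentiable (at y)" "g differentiable (at y)"
  shows "partial_deriv b (\<lambda>y. f y + g y) y = partial_deriv b f y + partial_deriv b g y"
  unfolding partial_deriv_def[of _ "\<lambda>y. f y + g y"]
  by (intro DERIV_imp_deriv derivative_intros differentiable_has_partial_deriv assms)

lemma C_on_add:
  assumes "open U" "C_on k U f" "C_on k U g"
  shows "C_on k U (\<lambda>y. f y + g y)"
  using assms(2,3)
proof (induction k arbitrary: f g)
  case 0
  then show ?case by (simp add: continuous_on_add)
next
  case (Suc k)
  have "C_on k U (partial_deriv b (\<lambda>y. f y + g y))" if "b \<in> Basis" for b
    by (rule C_on_cong[OF \<open>open U\<close>, where f = "\<lambda>y. partial_deriv b f y + partial_deriv b g y"])
       (use Suc that in \<open>auto simp: partial_deriv_add\<close>)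
  then show ?case using Suc.prems by auto
qed

lemma C_on_zero: "C_on k U (\<lambda>_. 0)"
  by (induction k) (auto simp: partial_deriv_def[abs_def])

lemma C_on_sum:
  assumes "open U" "finite B" "\<And>b. b \<in> B \<Longrightarrow> C_on k U (f b)"
  shows "C_on k U (\<lambda>y. \<Sum>b\<in>B. f b y)"
  using assms(2,3) by (induction B rule: finite_induct) (auto intro: C_on_add[OF \<open>open U\<close>] C_on_zero)

lemma C_on_laplacian:
  assumes "open U" "C_on (Suc (Suc k)) U f"
  shows "C_on k U (laplacian f)"
  unfolding laplacian_def[abs_def] using assms by (intro C_on_sum) auto

subsection \<open>Weighted averages and their expansion\<close>

text \<open>The radius occurs only in the integrand, so one can differentiate under the integral,
  and \<open>\<epsilon>\<close> may be zero or negative. The mass of the weight is not divided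
  out.\<close>

definition wavg :: "nat \<Rightarrow> ('a::euclidean_space \<Rightarrow> real) \<Rightarrow> 'a \<Rightarrow> real \<Rightarrow> real" where
  "wavg m f x \<epsilon> = integral bigbox (\<lambda>h. f (x + \<epsilon> *\<^sub>R h) * wt m h)"

text \<open>The displacement \<open>c\<close> leaves room for the translations in the integration by
  parts; \<open>c = 0\<close> covers the plain integrand.\<close>

lemma bigbox_scaling_radius:
  fixes x :: "'a::euclidean_space"
  assumes "open U" "x \<in> U"
  obtains r where "0 < r"
    "\<And>\<epsilon> h c. \<bar>\<epsilon>\<bar> < r \<Longrightarrow> h \<in> bigbox \<Longrightarrow> norm c \<le> 1 \<Longrightarrow> x + \<epsilon> *\<^sub>R (h + c) \<in> U"
proof -
  obtain e where e: "0 < e" "ball x e \<subseteq> U"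
    using assms by (meson open_contains_ball)
  obtain R where R: "\<And>h::'a. h \<in> bigbox \<Longrightarrow> norm h \<le> R"
    using bounded_cbox[unfolded bounded_iff] unfolding bigbox_def by metis
  have "0 \<in> (bigbox :: 'a set)" using cball_subset_bigbox by auto
  from R[OF this] have "0 \<le> R" by simp
  show ?thesis
  proof (rule that[of "e / (R + 1)"])
    show "0 < e / (R + 1)" using \<open>0 \<le> R\<close> e by simp
    fix \<epsilon> :: real and h c :: 'a
    assume a: "\<bar>\<epsilon>\<bar> < e / (R + 1)" "h \<in> bigbox" "norm c \<le> 1"
    have "norm (h + c) \<le> R + 1"
      using R[OF a(2)] a(3) norm_triangle_ineq[of h c] by linarith
    then have "\<bar>\<epsilon>\<bar> * norm (h + c) \<le> \<bar>\<epsilon>\<bar> * (R + 1)" by (simp add: mult_left_mono)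
    also have "\<dots> < e" using a(1) \<open>0 \<le> R\<close> by (simp add: field_simps)
    finally show "x + \<epsilon> *\<^sub>R (h + c) \<in> U"
      using e(2) by (auto simp: dist_norm subset_iff)
  qed
qed

text \<open>Differentiating under the integral gives the sum of
  \<open>(h \<bullet> b) * partial_deriv b f\<close> against \<open>wt m\<close>. Integration by
  parts trades \<open>h \<bullet> b\<close> and \<open>wt m\<close> for a second partial derivative
  and \<open>wt (Suc m)\<close>; the inner scaling contributes \<open>\<epsilon>\<close>.\<close>

lemma has_field_derivative_wavg:
  fixes x :: "'a::euclidean_space"
  assumes "open U" and C: "C_on (Suc (Suc 0)) U f" and "\<bar>\<epsilon>\<bar> < r"
    and r: "\<And>\<epsilon> h c. \<bar>\<epsilon>\<bar> < r \<Longrightarrow> h \<in> bigbox \<Longrightarrow> norm c \<le> 1 \<Longrightarrow> x + \<epsilon> *\<^sub>R (h + c) \<in> U"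
  shows "(wavg m f x has_field_derivative \<epsilon> / (2 * real m + 3) * wavg (Suc m) (laplacian f) x \<epsilon>) (at \<epsilon>)"
proof -
  let ?p = "\<lambda>b. partial_deriv b f"
  have r0: "x + \<epsilon> *\<^sub>R h \<in> U" if "\<bar>\<epsilon>\<bar> < r" "h \<in> bigbox" for \<epsilon> h
    using r[OF that, of 0] by simp
  have df: "f differentiable (at y)" if "y \<in> U" for y
    using C that by simp
  have dp: "?p b differentiable (at y)" if "y \<in> U" "b \<in> Basis" for y b
    using C that by simp
  have cf: "continuous_on U f" using C by (rule C_on_imp_continuous_on)
  have cp: "continuous_on U (?p b)" "continuous_on U (partial_deriv b (?p b))" if "b \<in> Basis" for b
    using C that C_on_imp_continuous_on[of "Suc 0" U "?p b"] by auto
  define G where "G \<epsilon> h = (\<Sum>b\<in>Basis. (h \<bullet> b) * ?p b (x + \<epsilon> *\<^sub>R h)) * wt m h" for \<epsilon> h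
  let ?T = "{-r<..<r}"
  have "((\<lambda>\<epsilon>. integral bigbox (\<lambda>h. f (x + \<epsilon> *\<^sub>R h) * wt m h)) has_field_derivative
          integral bigbox (G \<epsilon>)) (at \<epsilon> within ?T)"
    unfolding bigbox_def
  proof (rule leibniz_rule_field_derivative[where fx = G], unfold bigbox_def[symmetric])
    show "((\<lambda>\<epsilon>. f (x + \<epsilon> *\<^sub>R h) * wt m h) has_field_derivative G \<epsilon> h) (at \<epsilon> within ?T)"
      if "\<epsilon> \<in> ?T" "h \<in> bigbox" for \<epsilon> h
      unfolding G_def using that
      by (intro DERIV_cmult_right has_field_derivative_at_within[OF has_field_derivative_radial] df r0) auto
    show "(\<lambda>h. f (x + \<epsilon> *\<^sub>R h) * wt m h) integrable_on bigbox" if "\<epsilon> \<in> ?T" for \<epsilon>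
      by (intro integrable_on_bigbox continuous_intros continuous_on_compose2[OF cf])
         (use r0 that in auto)
    show "continuous_on (?T \<times> bigbox) (\<lambda>(\<epsilon>, h). G \<epsilon> h)"
      unfolding case_prod_beta G_def
      by (intro continuous_intros continuous_on_compose2[OF cp(1)]) (use r0 in auto)
  qed (use assms in auto)
  then have "(wavg m f x has_field_derivative integral bigbox (G \<epsilon>)) (at \<epsilon>)"
    using \<open>\<bar>\<epsilon>\<bar> < r\<close> unfolding wavg_def[abs_def] by (subst (asm) at_within_open) auto
  moreover have "integral bigbox (G \<epsilon>) = \<epsilon> / (2 * real m + 3) * wavg (Suc m) (laplacian f) x \<epsilon>"
  proof -
    have i: "(\<lambda>h. ?p b (x + \<epsilon> *\<^sub>R h) * (h \<bullet> b) * wt m h) integrable_on bigbox"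
      "(\<lambda>h. (\<epsilon> * partial_deriv b (?p b) (x + \<epsilon> *\<^sub>R h)) * wt (Suc m) h) integrable_on bigbox"
      if "b \<in> Basis" for b
      by (intro integrable_on_bigbox continuous_intros continuous_on_compose2[OF cp(1)]
           continuous_on_compose2[OF cp(2)]; use r0 \<open>\<bar>\<epsilon>\<bar> < r\<close> that in auto)+
    have ibp: "(2 * real m + 3) * integral bigbox (\<lambda>h. ?p b (x + \<epsilon> *\<^sub>R h) * (h \<bullet> b) * wt m h)
        = integral bigbox (\<lambda>h. (\<epsilon> * partial_deriv b (?p b) (x + \<epsilon> *\<^sub>R h)) * wt (Suc m) h)"
      if b: "b \<in> Basis" for b
    proof (rule integral_by_parts_wt[OF b, where S = "{h. x + \<epsilon> *\<^sub>R h \<in> U}"])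
      show "h + t *\<^sub>R b \<in> {h. x + \<epsilon> *\<^sub>R h \<in> U}" if "h \<in> bigbox" "\<bar>t\<bar> \<le> 1" for h t
        using r[OF \<open>\<bar>\<epsilon>\<bar> < r\<close> that(1), of "t *\<^sub>R b"] that(2) b by simp
      show "((\<lambda>t. ?p b (x + \<epsilon> *\<^sub>R (h + t *\<^sub>R b))) has_field_derivative
               \<epsilon> * partial_deriv b (?p b) (x + \<epsilon> *\<^sub>R h)) (at 0)"
        if "h \<in> {h. x + \<epsilon> *\<^sub>R h \<in> U}" for h
      proof -
        \<comment> \<open>Writing the point as \<open>\<epsilon> * 0\<close> matches the inner map
          of the chain rule, multiplication by \<open>\<epsilon>\<close>; the case
          \<open>\<epsilon> = 0\<close> is included.\<close>
        have "((\<lambda>t. ?p b (x + \<epsilon> *\<^sub>R h + t *\<^sub>R b)) has_field_derivative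
            partial_deriv b (?p b) (x + \<epsilon> *\<^sub>R h)) (at (\<epsilon> * 0))"
          using differentiable_has_partial_deriv[OF dp[OF _ b]] that by simp
        from DERIV_chain2[OF this DERIV_cmult_Id[of \<epsilon> 0]]
        show ?thesis by (simp add: algebra_simps)
      qed
    qed (intro continuous_intros continuous_on_compose2[OF cp(1)[OF b]]
           continuous_on_compose2[OF cp(2)[OF b]]; auto)+
    have "(2 * real m + 3) * integral bigbox (G \<epsilon>)
        = (2 * real m + 3) * integral bigbox (\<lambda>h. \<Sum>b\<in>Basis. ?p b (x + \<epsilon> *\<^sub>R h) * (h \<bullet> b) * wt m h)"
      unfolding G_def by (simp add: sum_distrib_left sum_distrib_right mult_ac)
    also have "\<dots> = (\<Sum>b\<in>Basis. integral bigbox (\<lambda>h. (\<epsilon> * partial_deriv b (?p b) (x + \<epsilon> *\<^sub>R h)) * wt (Suc m) h))"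
      by (subst integral_sum) (auto simp: i sum_distrib_left ibp)
    also have "\<dots> = integral bigbox (\<lambda>h. \<Sum>b\<in>Basis. (\<epsilon> * partial_deriv b (?p b) (x + \<epsilon> *\<^sub>R h)) * wt (Suc m) h)"
      by (rule integral_sum[symmetric]) (auto simp: i)
    also have "\<dots> = integral bigbox (\<lambda>h. \<epsilon> * (laplacian f (x + \<epsilon> *\<^sub>R h) * wt (Suc m) h))"
      unfolding laplacian_def by (simp add: sum_distrib_left sum_distrib_right mult_ac)
    also have "\<dots> = \<epsilon> * wavg (Suc m) (laplacian f) x \<epsilon>"
      unfolding wavg_def by simp
    finally show ?thesis by (simp add: field_simps)
  qed
  ultimately show ?thesis by simp
qed

section \<open>Coefficient recursion and integration of remainders\<close>

lemma smallo_one_iff: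
  fixes f :: "real \<Rightarrow> real"
  shows "f \<in> o[F](\<lambda>_. 1) \<longleftrightarrow> (f \<longlongrightarrow> 0) F"
  using smalloI_tendsto[of f "\<lambda>_. 1" F] smalloD_tendsto[of f F "\<lambda>_. 1"] by auto

text \<open>Removing the first factor \<open>n + 3\<close> from the product leaves the product for
  \<open>n + 2\<close>. The factor \<open>2 * Suc j\<close> is what differentiating
  \<open>\<epsilon> ^ (2 * Suc j)\<close> brings down.\<close>

lemma expansion_coeff_Suc:
  "expansion_coeff (Suc j) n * (2 * real (Suc j) * (real n + 3)) = expansion_coeff j (n + 2)"
proof -
  have "(\<Prod>i=1..Suc j. real (n + 2 * i + 1)) = (real n + 3) * (\<Prod>i=1..j. real (n + 2 + 2 * i + 1))"
    by (induction j) simp_all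
  then show ?thesis
    by (simp add: expansion_coeff_def del: of_nat_Suc prod.cl_ivl_Suc of_nat_add)
qed

text \<open>The mean value theorem gives \<open>g \<epsilon> = \<epsilon> * g' z\<close> with
  \<open>z\<close> between 0 and \<open>\<epsilon>\<close>, so a bound on \<open>g'\<close> gains
  one power with no integral of \<open>g'\<close>.\<close>

lemma smallo_integrate_power:
  fixes g g' :: "real \<Rightarrow> real"
  assumes "0 < r" "g 0 = 0"
    and der: "\<And>\<epsilon>. \<bar>\<epsilon>\<bar> < r \<Longrightarrow> (g has_field_derivative g' \<epsilon>) (at \<epsilon>)"
    and o: "g' \<in> o[at_right 0](\<lambda>\<epsilon>. \<epsilon> ^ p)"
  shows "g \<in> o[at_right 0](\<lambda>\<epsilon>. \<epsilon> ^ Suc p)"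
proof (rule landau_o.smallI)
  fix c :: real assume "0 < c"
  from landau_o.smallD[OF o this] obtain d where d: "0 < d"
    "\<And>\<epsilon>. 0 < \<epsilon> \<Longrightarrow> \<epsilon> < d \<Longrightarrow> norm (g' \<epsilon>) \<le> c * norm (\<epsilon> ^ p)"
    unfolding eventually_at_right_field by auto
  have "norm (g \<epsilon>) \<le> c * norm (\<epsilon> ^ Suc p)" if \<epsilon>: "0 < \<epsilon>" "\<epsilon> < min d r" for \<epsilon>
  proof -
    have "\<exists>z>0. z < \<epsilon> \<and> g \<epsilon> - g 0 = (\<epsilon> - 0) * g' z"
      using \<epsilon> by (intro MVT2 der) auto
    then obtain z where z: "0 < z" "z < \<epsilon>" "g \<epsilon> = \<epsilon> * g' z"
      using \<open>g 0 = 0\<close> by auto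
    have "norm (g' z) \<le> c * z ^ p" using d(2)[of z] z \<epsilon> by simp
    also have "\<dots> \<le> c * \<epsilon> ^ p" using z \<open>0 < c\<close> by (intro mult_left_mono power_mono) auto
    finally have "\<epsilon> * norm (g' z) \<le> \<epsilon> * (c * \<epsilon> ^ p)" using \<epsilon> by (intro mult_left_mono) auto
    then show ?thesis using z \<epsilon> by (simp add: abs_mult mult_ac)
  qed
  then show "\<forall>\<^sub>F \<epsilon> in at_right 0. norm (g \<epsilon>) \<le> c * norm (\<epsilon> ^ Suc p)"
    unfolding eventually_at_right_field using d(1) \<open>0 < r\<close> by (intro exI[of _ "min d r"]) auto
qed

text \<open>The induction keeps \<open>m\<close> and \<open>f\<close> general because the step uses
  the hypothesis for \<open>Suc m\<close> and \<open>laplacian f\<close>. The remainder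
  \<open>g\<close> vanishes at 0, and its derivative is \<open>\<epsilon> / (2 * real m + 3)\<close>
  times the remainder \<open>q\<close> of those data.\<close>

lemma wavg_expansion:
  fixes x :: "'a::euclidean_space"
  assumes "open U" "x \<in> U" "C_on (2 * k) U f"
  shows "(\<lambda>\<epsilon>. wavg m f x \<epsilon> - integral bigbox (wt m :: 'a \<Rightarrow> real)
            * (\<Sum>j=0..k. expansion_coeff j (DIM('a) + 2 * m) * \<epsilon> ^ (2 * j) * (laplacian ^^ j) f x))
         \<in> o[at_right 0](\<lambda>\<epsilon>. \<epsilon> ^ (2 * k))"
  using assms(3)
proof (induction k arbitrary: m f)
  case 0
  \<comment> \<open>For \<open>k = 0\<close> the claim is just continuity of the average at
    0.\<close>
  then have cf: "continuous_on U f" by simp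
  obtain r where "0 < r" and r:
    "\<And>\<epsilon> h c. \<bar>\<epsilon>\<bar> < r \<Longrightarrow> h \<in> bigbox \<Longrightarrow> norm c \<le> 1 \<Longrightarrow> x + \<epsilon> *\<^sub>R (h + c) \<in> U"
    using bigbox_scaling_radius assms(1,2) by blast
  have r0: "x + \<epsilon> *\<^sub>R h \<in> U" if "\<bar>\<epsilon>\<bar> < r" "h \<in> bigbox" for \<epsilon> h
    using r[OF that, of 0] by simp
  let ?T = "{-r<..<r}"
  have "continuous_on ?T (wavg m f x)"
    unfolding wavg_def[abs_def] bigbox_def
    by (rule integral_continuous_on_param, unfold bigbox_def[symmetric] case_prod_beta,
        intro continuous_intros continuous_on_compose2[OF cf]) (use r0 in auto)
  then have "isCont (wavg m f x) 0"
    using \<open>0 < r\<close> by (simp add: continuous_on_eq_continuous_at)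
  then have "(wavg m f x \<longlongrightarrow> wavg m f x 0) (at_right 0)"
    by (auto simp: isCont_def intro: tendsto_within_subset)
  then have "((\<lambda>\<epsilon>. wavg m f x \<epsilon> - integral bigbox (wt m :: 'a \<Rightarrow> real) * f x) \<longlongrightarrow> 0) (at_right 0)"
    by (subst LIM_zero_iff) (simp add: wavg_def mult.commute)
  then show ?case
    by (simp add: expansion_coeff_def smallo_one_iff)
next
  case (Suc k)
  have C: "C_on (Suc (Suc (2 * k))) U f" using Suc.prems by simp
  have C2: "C_on (Suc (Suc 0)) U f"
    using C by (auto intro: C_on_imp_continuous_on[of "2 * k"])
  obtain r where "0 < r" and r:
    "\<And>\<epsilon> h c. \<bar>\<epsilon>\<bar> < r \<Longrightarrow> h \<in> bigbox \<Longrightarrow> norm c \<le> 1 \<Longrightarrow> x + \<epsilon> *\<^sub>R (h + c) \<in> U"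
    using bigbox_scaling_radius assms(1,2) by blast
  define W where "W m = integral bigbox (wt m :: 'a \<Rightarrow> real)" for m
  let ?n = "DIM('a) + 2 * m"
  let ?e = "\<lambda>j. expansion_coeff j ?n" and ?e' = "\<lambda>j. expansion_coeff j (DIM('a) + 2 * Suc m)"
  let ?L = "\<lambda>j. (laplacian ^^ j) f x"
  define q where "q \<epsilon> = wavg (Suc m) (laplacian f) x \<epsilon> - W (Suc m)
            * (\<Sum>j=0..k. ?e' j * \<epsilon> ^ (2 * j) * (laplacian ^^ j) (laplacian f) x)" for \<epsilon>
  define g where "g \<epsilon> = wavg m f x \<epsilon> - W m * (\<Sum>j=0..Suc k. ?e j * \<epsilon> ^ (2 * j) * ?L j)" for \<epsilon>
  have q: "q \<in> o[at_right 0](\<lambda>\<epsilon>. \<epsilon> ^ (2 * k))"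
    unfolding q_def W_def by (rule Suc.IH) (rule C_on_laplacian[OF assms(1) C])
  \<comment> \<open>The mass identity turns \<open>(2 * real m + 3) * W m\<close> into
    \<open>(real ?n + 3) * W (Suc m)\<close>, and \<open>real ?n + 3\<close> is the factor absorbed
    by \<open>expansion_coeff_Suc\<close>.\<close>
  have coeff: "W m * (?e (Suc j) * (2 * real (Suc j))) = W (Suc m) * ?e' j / (2 * real m + 3)" for j
  proof -
    have pos: "0 < 2 * real m + 3" "0 < real ?n + 3" by simp_all
    have "(2 * real m + 3) * (W m * (?e (Suc j) * (2 * real (Suc j))))
        = W (Suc m) * (?e (Suc j) * (2 * real (Suc j) * (real ?n + 3)))"
      using integral_wt_Suc[of m, where 'a = 'a] unfolding W_def[symmetric] by (simp add: mult_ac)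
    also have "\<dots> = W (Suc m) * ?e' j"
      using expansion_coeff_Suc[of j ?n] by (simp only: add_Suc_right mult_Suc_right) (simp add: add_ac)
    finally show ?thesis using pos by (simp add: field_simps)
  qed
  \<comment> \<open>The isolated constant term has coefficient 1; it makes \<open>g 0 = 0\<close>
    and disappears on differentiation.\<close>
  have sum: "(\<Sum>j=0..Suc k. ?e j * \<epsilon> ^ (2 * j) * ?L j)
      = ?L 0 + (\<Sum>j=0..k. ?e (Suc j) * \<epsilon> ^ (2 * Suc j) * ?L (Suc j))" for \<epsilon>
    by (simp only: sum.atLeast0_atMost_Suc_shift) (simp add: expansion_coeff_def)
  have "g \<in> o[at_right 0](\<lambda>\<epsilon>. \<epsilon> ^ Suc (Suc (2 * k)))"
  proof (rule smallo_integrate_power[OF \<open>0 < r\<close>])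
    have "wavg m f x 0 = W m * f x" by (simp add: wavg_def W_def mult.commute)
    then show "g 0 = 0" unfolding g_def sum by simp
    show "(g has_field_derivative \<epsilon> / (2 * real m + 3) * q \<epsilon>) (at \<epsilon>)" if "\<bar>\<epsilon>\<bar> < r" for \<epsilon>
    proof -
      have "((\<lambda>\<epsilon>. ?e (Suc j) * \<epsilon> ^ (2 * Suc j) * ?L (Suc j)) has_field_derivative
           ?e (Suc j) * (2 * real (Suc j)) * \<epsilon> ^ (2 * j + 1) * ?L (Suc j)) (at \<epsilon>)" for j
        by (rule DERIV_cong[OF DERIV_cmult_right[OF DERIV_cmult[OF DERIV_pow]]]) simp
      then have "(g has_field_derivative \<epsilon> / (2 * real m + 3) * wavg (Suc m) (laplacian f) x \<epsilon>
          - W m * (0 + (\<Sum>j=0..k. ?e (Suc j) * (2 * real (Suc j)) * \<epsilon> ^ (2 * j + 1) * ?L (Suc j)))) (at \<epsilon>)"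
        unfolding g_def[abs_def] sum
        by (intro DERIV_diff has_field_derivative_wavg[OF assms(1) C2 that r] DERIV_cmult
              DERIV_add DERIV_const DERIV_sum)
      moreover have "W m * (\<Sum>j=0..k. ?e (Suc j) * (2 * real (Suc j)) * \<epsilon> ^ (2 * j + 1) * ?L (Suc j))
        = \<epsilon> / (2 * real m + 3) * (W (Suc m)
            * (\<Sum>j=0..k. ?e' j * \<epsilon> ^ (2 * j) * (laplacian ^^ j) (laplacian f) x))"
        unfolding sum_distrib_left
      proof (rule sum.cong[OF refl])
        fix j
        have "W m * (?e (Suc j) * (2 * real (Suc j)) * \<epsilon> ^ (2 * j + 1) * ?L (Suc j))
          = (W m * (?e (Suc j) * (2 * real (Suc j)))) * \<epsilon> ^ (2 * j + 1) * ?L (Suc j)"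
          by (simp only: mult_ac)
        also have "\<dots> = \<epsilon> / (2 * real m + 3) * (W (Suc m) * (?e' j * \<epsilon> ^ (2 * j) * ?L (Suc j)))"
          unfolding coeff by simp
        finally show "W m * (?e (Suc j) * (2 * real (Suc j)) * \<epsilon> ^ (2 * j + 1) * ?L (Suc j))
          = \<epsilon> / (2 * real m + 3) * (W (Suc m) * (?e' j * \<epsilon> ^ (2 * j) * (laplacian ^^ j) (laplacian f) x))"
          by (simp add: funpow_swap1)
      qed
      ultimately show ?thesis unfolding q_def by (simp add: right_diff_distrib)
    qed
    \<comment> \<open>The factor \<open>\<epsilon>\<close> gains one order; the integration gains
      the second.\<close>
    have "(\<lambda>\<epsilon>. \<epsilon> * q \<epsilon>) \<in> o[at_right 0](\<lambda>\<epsilon>. \<epsilon> * \<epsilon> ^ (2 * k))"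
      by (rule landau_o.small.mult_left[OF q])
    then have "(\<lambda>\<epsilon>. (1 / (2 * real m + 3)) * (\<epsilon> * q \<epsilon>)) \<in> o[at_right 0](\<lambda>\<epsilon>. \<epsilon> * \<epsilon> ^ (2 * k))"
      by (intro landau_o.small.cmult_in_iff[THEN iffD2]) auto
    then show "(\<lambda>\<epsilon>. \<epsilon> / (2 * real m + 3) * q \<epsilon>) \<in> o[at_right 0](\<lambda>\<epsilon>. \<epsilon> ^ Suc (2 * k))"
      by simp
  qed
  then show ?case unfolding g_def[abs_def] W_def by simp
qed

section \<open>Uniqueness of the expansion and the Gamma form\<close>

text \<open>The limit at 0 forces \<open>c 0 = 0\<close>; dividing by \<open>\<epsilon>\<close>
  lowers the degree. Applied to a difference of two expansions, this yields the absence of odd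
  powers.\<close>

lemma polynomial_smallo_at_0_imp_zero:
  fixes c :: "nat \<Rightarrow> real"
  assumes "(\<lambda>\<epsilon>. \<Sum>m=0..N. c m * \<epsilon> ^ m) \<in> o[at_right 0](\<lambda>\<epsilon>. \<epsilon> ^ N)"
  shows "\<forall>m\<le>N. c m = 0"
  using assms
proof (induction N arbitrary: c)
  case 0
  then show ?case by (simp add: smallo_one_iff tendsto_const_iff)
next
  case (Suc N)
  let ?p = "\<lambda>\<epsilon>. \<Sum>m=0..Suc N. c m * \<epsilon> ^ m"
  have lim: "((\<lambda>\<epsilon>::real. \<epsilon> ^ n) \<longlongrightarrow> 0 ^ n) (at_right 0)" for n
    by (intro tendsto_intros)
  have "(?p \<longlongrightarrow> (\<Sum>m=0..Suc N. c m * 0 ^ m)) (at_right 0)"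
    by (intro tendsto_intros)
  also have "(\<Sum>m=0..Suc N. c m * 0 ^ m) = c 0"
    by (simp only: sum.atLeast0_atMost_Suc_shift) simp
  finally have "(?p \<longlongrightarrow> c 0) (at_right 0)" .
  moreover have "?p \<in> o[at_right 0](\<lambda>_. 1)"
  proof (rule landau_o.small_big_trans[OF Suc.prems])
    show "(\<lambda>\<epsilon>::real. \<epsilon> ^ Suc N) \<in> O[at_right 0](\<lambda>_. 1)"
      using lim[of "Suc N"] by (intro landau_o.small_imp_big) (simp add: smallo_one_iff)
  qed
  then have "(?p \<longlongrightarrow> 0) (at_right 0)" by (simp only: smallo_one_iff)
  ultimately have c0: "c 0 = 0" by (intro tendsto_unique[of "at_right 0"]) auto
  have "?p = (\<lambda>\<epsilon>. \<epsilon> * (\<Sum>m=0..N. c (Suc m) * \<epsilon> ^ m))"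
    by (simp only: sum.atLeast0_atMost_Suc_shift) (simp add: c0 sum_distrib_left mult_ac)
  with Suc.prems have "(\<lambda>\<epsilon>. \<epsilon> * (\<Sum>m=0..N. c (Suc m) * \<epsilon> ^ m)) \<in> o[at_right 0](\<lambda>\<epsilon>. \<epsilon> * \<epsilon> ^ N)"
    by simp
  then have "(\<lambda>\<epsilon>. \<Sum>m=0..N. c (Suc m) * \<epsilon> ^ m) \<in> o[at_right 0](\<lambda>\<epsilon>. \<epsilon> ^ N)"
    by (subst (asm) landau_o.small.mult_cancel_left) (auto simp: eventually_at_filter)
  from Suc.IH[OF this] have "c (Suc m) = 0" if "m \<le> N" for m using that by simp
  then show ?case using c0 by (metis Suc_le_mono not0_implies_Suc)
qed

text \<open>With \<open>z = (n + 3) / 2\<close> each factor is \<open>2 * (z + i - 1)\<close>, so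
  the product is \<open>2 ^ j\<close> times a rising factorial, a quotient of Gamma values.\<close>

lemma expansion_coeff_Gamma:
  "expansion_coeff j n = 1 / (4 ^ j * fact j)
     * (Gamma ((real n + 3) / 2) / Gamma (real j + (real n + 3) / 2))"
proof -
  let ?z = "(real n + 3) / 2"
  have "(\<Prod>i=1..j. real (n + 2 * i + 1)) = 2 ^ j * pochhammer ?z j"
  proof (induction j)
    case (Suc j)
    then show ?case by (simp add: pochhammer_Suc field_simps)
  qed simp
  moreover have "?z \<notin> \<int>\<^sub>\<le>\<^sub>0" by (auto elim!: nonpos_Ints_cases simp: field_simps)
  then have "pochhammer ?z j = Gamma (?z + real j) / Gamma ?z"
    by (rule pochhammer_Gamma)
  moreover have "(2::real) ^ j * 2 ^ j = 4 ^ j" by (simp flip: power_mult_distrib)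
  ultimately show ?thesis
    by (simp add: expansion_coeff_def add.commute mult_ac flip: power_mult_distrib)
qed

subsection \<open>Normalization and rescaling\<close>

text \<open>Cavalieri's principle: the slice of the ball over \<open>h\<close> is an interval of
  half-length \<open>wt 0 h\<close>, empty when \<open>1 \<le> norm h\<close>.\<close>

lemma measure_unit_ball_prod:
  "measure lborel (ball (0 :: 'a::euclidean_space \<times> real) 1) = 2 * integral bigbox (wt 0 :: 'a \<Rightarrow> real)"
proof -
  have c: "continuous_on S (wt 0 :: 'a \<Rightarrow> real)" for S
    using continuous_on_wt[OF continuous_on_id] by simp
  \<comment> \<open>This links the gauge integral over the box to the Lebesgue integral that slicing
    produces.\<close>
  have i: "set_integrable lborel bigbox (wt 0 :: 'a \<Rightarrow> real)"
    unfolding bigbox_def set_integrable_def by (intro borel_integrable_compact c) auto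
  have ind: "(\<lambda>h::'a. indicator bigbox h *\<^sub>R wt 0 h) = wt 0"
    by (auto simp: fun_eq_iff indicator_def wt_eq_0_outside)
  have i': "integrable lborel (wt 0 :: 'a \<Rightarrow> real)"
    using i unfolding set_integrable_def ind .
  have I: "integral\<^sup>L lborel (wt 0 :: 'a \<Rightarrow> real) = integral bigbox (wt 0 :: 'a \<Rightarrow> real)"
    using set_borel_integral_eq_integral(2)[OF i] unfolding set_lebesgue_integral_def ind .
  have slice: "emeasure lborel (Pair h -` ball (0 :: 'a \<times> real) 1) = ennreal (2 * wt 0 h)" for h :: 'a
  proof -
    have "norm (h, t) < 1 \<longleftrightarrow> (norm h)\<^sup>2 + t\<^sup>2 < 1" for t
      by (simp add: norm_Pair)
    then have S: "Pair h -` ball (0 :: 'a \<times> real) 1 = {t. t\<^sup>2 < 1 - (norm h)\<^sup>2}"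
      by (auto simp del: mem_ball simp: mem_ball_0)
    show ?thesis
    proof (cases "0 < 1 - (norm h)\<^sup>2")
      case True
      let ?s = "sqrt (1 - (norm h)\<^sup>2)"
      have t: "t\<^sup>2 < 1 - (norm h)\<^sup>2 \<longleftrightarrow> \<bar>t\<bar> < ?s" for t
        by (metis real_sqrt_abs real_sqrt_less_iff)
      have "Pair h -` ball (0 :: 'a \<times> real) 1 = {- ?s<..<?s}"
        unfolding S t abs_less_iff greaterThanLessThan_eq greaterThan_def lessThan_def by auto
      moreover have "wt 0 h = ?s" using True by (simp add: wt_def)
      ultimately show ?thesis using True by simp
    next
      case False
      then have "Pair h -` ball (0 :: 'a \<times> real) 1 = {}"
        unfolding S using zero_le_power2 less_le_trans not_le by blast
      moreover have "wt 0 h = 0" using False by (simp add: wt_def)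
      ultimately show ?thesis by simp
    qed
  qed
  have "emeasure lborel (ball (0 :: 'a \<times> real) 1)
      = emeasure (lborel \<Otimes>\<^sub>M lborel) (ball (0 :: 'a \<times> real) 1)"
    by (simp add: lborel_prod)
  also have "\<dots> = (\<integral>\<^sup>+h. emeasure lborel (Pair h -` ball (0 :: 'a \<times> real) 1) \<partial>lborel)"
    by (rule lborel.emeasure_pair_measure_alt) (unfold lborel_prod, simp)
  also have "\<dots> = (\<integral>\<^sup>+h. ennreal (2 * wt 0 (h::'a)) \<partial>lborel)"
    unfolding slice ..
  also have "\<dots> = ennreal (2 * integral bigbox (wt 0 :: 'a \<Rightarrow> real))"
    by (subst nn_integral_eq_integral) (auto intro!: i' AE_I2 wt_nonneg simp: I)
  finally have "emeasure lborel (ball (0 :: 'a \<times> real) 1) = ennreal (2 * integral bigbox (wt 0 :: 'a \<Rightarrow> real))" .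
  moreover have "0 \<le> integral bigbox (wt 0 :: 'a \<Rightarrow> real)"
    unfolding I[symmetric] by (rule Bochner_Integration.integral_nonneg) (rule wt_nonneg)
  ultimately show ?thesis
    by (simp add: measure_def)
qed

lemma lborel_integral_scaleR:
  fixes f :: "'a::euclidean_space \<Rightarrow> real"
  assumes [measurable]: "f \<in> borel_measurable borel" and "0 < c"
  shows "integral\<^sup>L lborel f = c ^ DIM('a) * integral\<^sup>L lborel (\<lambda>h. f (c *\<^sub>R h))"
  using assms(2)
  by (subst lborel_affine[of c 0]) (auto simp: integral_density integral_distr)

text \<open>After scaling, the volume element and the square root contribute
  \<open>\<epsilon> ^ (n + 1)\<close>, with \<open>n = DIM('a)\<close>, which cancels the same power
  in the ball volume. What remains is \<open>2 / V\<close>, the reciprocal of the mass of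
  \<open>wt 0\<close>.\<close>

lemma set_integral_rho:
  fixes x :: "'a::euclidean_space"
  assumes "0 < \<epsilon>" "\<epsilon> < r" and cf: "continuous_on U f"
    and r: "\<And>\<epsilon> h c. \<bar>\<epsilon>\<bar> < r \<Longrightarrow> h \<in> bigbox \<Longrightarrow> norm c \<le> 1 \<Longrightarrow> x + \<epsilon> *\<^sub>R (h + c) \<in> U"
  shows "(LINT h:ball 0 \<epsilon>|lborel. f (x + h) * rho \<epsilon> h) = wavg 0 f x \<epsilon> / integral bigbox (wt 0 :: 'a \<Rightarrow> real)"
proof -
  let ?n = "DIM('a)"
  define V where "V = measure lborel (ball (0 :: 'a \<times> real) 1)"
  have "V > 0" unfolding V_def by simp
  have V\<epsilon>: "measure lborel (ball (0 :: 'a \<times> real) \<epsilon>) = \<epsilon> ^ Suc ?n * V"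
    unfolding V_def using assms(1) by (simp add: content_ball)
  have r0: "x + \<epsilon> *\<^sub>R h \<in> U" if "h \<in> bigbox" for h
    using r[OF _ that, of \<epsilon> 0] assms(1,2) by simp
  let ?F = "\<lambda>h. indicator (ball 0 \<epsilon>) h *\<^sub>R (f (x + h) * rho \<epsilon> h)"
  have ball: "h /\<^sub>R \<epsilon> \<in> bigbox" if "h \<in> ball 0 \<epsilon>" for h :: 'a
    using that assms(1) cball_subset_bigbox
    by (intro subsetD[OF cball_subset_bigbox]) (simp add: field_simps)
  have "x + h \<in> U" if "h \<in> ball 0 \<epsilon>" for h
    using r0[OF ball[OF that]] assms(1) by simp
  then have "(\<lambda>h. x + h) ` ball 0 \<epsilon> \<subseteq> U" by blast
  \<comment> \<open>Nothing is assumed about \<open>f\<close> off \<open>U\<close>, so measurability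
    comes from continuity on the ball and the indicator.\<close>
  then have "continuous_on (ball 0 \<epsilon>) (\<lambda>h. f (x + h) * rho \<epsilon> h)"
    unfolding rho_def V\<epsilon> using \<open>V > 0\<close> assms(1)
    by (intro continuous_intros continuous_on_compose2[OF cf]) (assumption | simp)+
  then have F: "?F \<in> borel_measurable borel"
    by (intro borel_measurable_continuous_on_indicator) auto
  have pt: "\<epsilon> ^ ?n * ?F (\<epsilon> *\<^sub>R h) = 2 / V * (indicator bigbox h *\<^sub>R (f (x + \<epsilon> *\<^sub>R h) * wt 0 h))" for h
  proof (cases "norm h < 1")
    case True
    then have "h \<in> bigbox" using cball_subset_bigbox by auto
    moreover have "(norm h)\<^sup>2 < 1" using True by (simp add: abs_square_less_1)
    moreover have "\<epsilon>\<^sup>2 - (norm (\<epsilon> *\<^sub>R h))\<^sup>2 = \<epsilon>\<^sup>2 * (1 - (norm h)\<^sup>2)"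
      by (simp add: power_mult_distrib algebra_simps)
    then have "sqrt (\<epsilon>\<^sup>2 - (norm (\<epsilon> *\<^sub>R h))\<^sup>2) = \<epsilon> * sqrt (1 - (norm h)\<^sup>2)"
      using assms(1) by (simp only: real_sqrt_mult) simp
    ultimately show ?thesis
      using True assms(1) \<open>V > 0\<close> unfolding rho_def V\<epsilon> by (simp add: wt_def field_simps)
  next
    case False
    then show ?thesis using assms(1) by (simp add: wt_eq_0)
  qed
  have si: "set_integrable lborel bigbox (\<lambda>h. f (x + \<epsilon> *\<^sub>R h) * wt 0 h)"
    unfolding bigbox_def set_integrable_def
    by (intro borel_integrable_compact continuous_intros continuous_on_compose2[OF cf])
       (use r0 in \<open>auto simp: bigbox_def\<close>)
  have "(LINT h:ball 0 \<epsilon>|lborel. f (x + h) * rho \<epsilon> h) = \<epsilon> ^ ?n * integral\<^sup>L lborel (\<lambda>h. ?F (\<epsilon> *\<^sub>R h))"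
    unfolding set_lebesgue_integral_def by (rule lborel_integral_scaleR[OF F assms(1)])
  also have "\<dots> = integral\<^sup>L lborel (\<lambda>h. \<epsilon> ^ ?n * ?F (\<epsilon> *\<^sub>R h))"
    by simp
  also have "\<dots> = 2 / V * (LINT h:bigbox|lborel. f (x + \<epsilon> *\<^sub>R h) * wt 0 h)"
    unfolding pt set_lebesgue_integral_def by simp
  also have "\<dots> = 2 / V * wavg 0 f x \<epsilon>"
    unfolding wavg_def using set_borel_integral_eq_integral(2)[OF si] by simp
  finally show ?thesis
    unfolding V_def measure_unit_ball_prod by simp
qed

section \<open>Assembly of the expansion and vanishing of odd coefficients\<close>

theorem mainTheorem2:
  fixes U :: "(real ^ 'n) set" and \<phi> :: "real ^ 'n \<Rightarrow> real" and x :: "real ^ 'n" and k :: nat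
  assumes "open U" and "k \<ge> 1" and "C_on (2 * k) U \<phi>" and "x \<in> U"
  shows "(\<lambda>\<epsilon>. (LINT h:ball 0 \<epsilon>|lborel. \<phi> (x + h) * rho \<epsilon> h)
              - (\<Sum>j=0..k. expansion_coeff j CARD('n) * \<epsilon> ^ (2 * j) * (laplacian ^^ j) \<phi> x))
           \<in> o[at_right 0](\<lambda>\<epsilon>. \<epsilon> ^ (2 * k))
      \<and> expansion_coeff 0 CARD('n) = 1
      \<and> (\<forall>j\<in>{1..k}. expansion_coeff j CARD('n)
           = 1 / (4 ^ j * fact j)
             * (Gamma ((real CARD('n) + 3) / 2) / Gamma (real j + (real CARD('n) + 3) / 2)))
      \<and> (\<forall>a :: nat \<Rightarrow> real.
           (\<lambda>\<epsilon>. (LINT h:ball 0 \<epsilon>|lborel. \<phi> (x + h) * rho \<epsilon> h) - (\<Sum>m=0..2*k. a m * \<epsilon> ^ m))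
             \<in> o[at_right 0](\<lambda>\<epsilon>. \<epsilon> ^ (2 * k))
           \<longrightarrow> (\<forall>m\<le>2*k. odd m \<longrightarrow> a m = 0))"
proof -
  let ?M = "\<lambda>\<epsilon>. LINT h:ball 0 \<epsilon>|lborel. \<phi> (x + h) * rho \<epsilon> h"
  let ?t = "\<lambda>j. expansion_coeff j CARD('n) * (laplacian ^^ j) \<phi> x"
  let ?P = "\<lambda>\<epsilon>. \<Sum>j=0..k. expansion_coeff j CARD('n) * \<epsilon> ^ (2 * j) * (laplacian ^^ j) \<phi> x"
  define W where "W = integral bigbox (wt 0 :: real ^ 'n \<Rightarrow> real)"
  have "0 < measure lborel (ball (0 :: (real ^ 'n) \<times> real) 1)" by simp
  then have "W > 0" unfolding W_def measure_unit_ball_prod by simp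
  obtain r where "0 < r" and r:
    "\<And>\<epsilon> h c. \<bar>\<epsilon>\<bar> < r \<Longrightarrow> h \<in> bigbox \<Longrightarrow> norm c \<le> 1 \<Longrightarrow> x + \<epsilon> *\<^sub>R (h + c) \<in> U"
    using bigbox_scaling_radius[OF assms(1,4)] by blast
  have W: "1 / W * (a - W * b) = a / W - b" for a b
    using \<open>W > 0\<close> by (simp add: field_simps)
  have "(\<lambda>\<epsilon>. 1 / W * (wavg 0 \<phi> x \<epsilon> - W * ?P \<epsilon>)) \<in> o[at_right 0](\<lambda>\<epsilon>. \<epsilon> ^ (2 * k))"
    using wavg_expansion[OF assms(1,4,3), of 0] \<open>W > 0\<close> unfolding W_def[symmetric]
    by (intro landau_o.small.cmult_in_iff[THEN iffD2]) auto
  \<comment> \<open>The rescaling identity is known for \<open>0 < \<epsilon> < r\<close>, which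
    suffices for a statement at \<open>0\<close> from the right.\<close>
  moreover have "\<forall>\<^sub>F \<epsilon> in at_right 0. 1 / W * (wavg 0 \<phi> x \<epsilon> - W * ?P \<epsilon>) = ?M \<epsilon> - ?P \<epsilon>"
    unfolding eventually_at_right_field
  proof (intro exI[of _ r] conjI allI impI)
    fix \<epsilon> :: real assume "0 < \<epsilon>" "\<epsilon> < r"
    from set_integral_rho[OF this C_on_imp_continuous_on[OF assms(3)] r]
    show "1 / W * (wavg 0 \<phi> x \<epsilon> - W * ?P \<epsilon>) = ?M \<epsilon> - ?P \<epsilon>"
      unfolding W W_def[symmetric] by (rule arg_cong2[OF sym refl])
  qed (rule \<open>0 < r\<close>)
  ultimately have main: "(\<lambda>\<epsilon>. ?M \<epsilon> - ?P \<epsilon>) \<in> o[at_right 0](\<lambda>\<epsilon>. \<epsilon> ^ (2 * k))"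
    by (rule landau_o.small.in_cong[THEN iffD1, rotated])
  have odd: "a m = 0"
    if a: "(\<lambda>\<epsilon>. ?M \<epsilon> - (\<Sum>m=0..2*k. a m * \<epsilon> ^ m)) \<in> o[at_right 0](\<lambda>\<epsilon>. \<epsilon> ^ (2 * k))"
      and m: "m \<le> 2 * k" "odd m" for a :: "nat \<Rightarrow> real" and m
  proof -
    \<comment> \<open>Padding with zero odd coefficients turns \<open>?P\<close> into a polynomial
      indexed by all powers up to \<open>2 * k\<close>.\<close>
    define b where "b m = (if even m then ?t (m div 2) else 0)" for m
    have P: "?P \<epsilon> = (\<Sum>m=0..2*k. b m * \<epsilon> ^ m)" for \<epsilon>
    proof -
      have "(\<Sum>m=0..2*k. b m * \<epsilon> ^ m) = (\<Sum>m\<in>(*) 2 ` {0..k}. b m * \<epsilon> ^ m)"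
        by (rule sum.mono_neutral_right) (auto simp: b_def elim!: evenE)
      also have "\<dots> = (\<Sum>j=0..k. b (2 * j) * \<epsilon> ^ (2 * j))"
        by (subst sum.reindex) (auto simp: inj_on_def)
      finally show ?thesis by (simp add: b_def mult_ac)
    qed
    \<comment> \<open>Subtracting the two expansions eliminates \<open>?M\<close> and leaves a
      polynomial with coefficients \<open>a m - b m\<close>.\<close>
    have "(\<lambda>\<epsilon>. (?M \<epsilon> - ?P \<epsilon>) - (?M \<epsilon> - (\<Sum>m=0..2*k. a m * \<epsilon> ^ m))) \<in> o[at_right 0](\<lambda>\<epsilon>. \<epsilon> ^ (2 * k))"
      by (rule sum_in_smallo(2)[OF main a])
    then have "(\<lambda>\<epsilon>. \<Sum>m=0..2*k. (a m - b m) * \<epsilon> ^ m) \<in> o[at_right 0](\<lambda>\<epsilon>. \<epsilon> ^ (2 * k))"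
      unfolding P by (simp add: left_diff_distrib sum_subtractf)
    from polynomial_smallo_at_0_imp_zero[OF this] show ?thesis
      using m by (simp add: b_def)
  qed
  show ?thesis
    by (intro conjI ballI allI impI main expansion_coeff_Gamma)
       (simp add: expansion_coeff_def, rule odd)
qed

end
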